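(* For all $\Gamma\cup\{A\}\subseteq\mathsf{Form}_{\bot,\supset}$: $\Gamma\vdash_{\bot_w}A$ iff $\Gamma\models_{\bot_w}A$.
   Context: $\mathsf{Form}_{\bot,\supset}$: formulas built from a countable set $\mathsf{Prop}$ of propositional variables and the constant $\bot$ using binary connectives $\land,\lor,\to,\supset$. Proof system $\mathbf{S}_{\bot_w}$: axiom schemata (for all formulas $A,B,C$) (Ax1) $A\to(B\to A)$; (Ax2) $(A\to(B\to C))\to((A\to B)\to(A\to C))$; (Ax3) $(A\land B)\to A$; (Ax4) $(A\land B)\to B$; (Ax5) $(C\to A)\to((C\to B)\to(C\to(A\land B)))$; (Ax6) $A\to(A\lor B)$; (Ax7) $B\to(A\lor B)$; (Ax8) $(A\to C)\to((B\to C)\to((A\lor B)\to C))$; (AxM1) $(A\to B)\supset(A\supset B)$; (AxM2) $(A\supset(B\supset C))\to((A\supset B)\supset(A\supset C))$; (AxM3) $(A\supset(B\to C))\to(B\to(A\supset C))$; (AxM4) $(A\to(B\supset C))\to(B\supset(A\to C))$; (AxM5) $((A\supset B)\supset C)\to((A\supset C)\to C)$; (AxM6) $(A\supset C)\to((B\supset C)\to((A\lor B)\supset C))$; (AxE) $\bot\supset A$; single rule: from $A$ and $A\supset B$ infer $B$. $\Gamma\vdash_{\bot_w}A$ iff there is a finite derivation of $A$ from members of $\Gamma$ and axiom instances using this rule. (No axiom $\bot\to A$.) Semantics: a model is $\langle g,W,\leq,V\rangle$ with $W$ a set, $g\in W$, $\leq$ reflexive and transitive with $g\leq w$ for all $w$,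 $V:W\times(\mathsf{Prop}\cup\{\bot\})\to\{0,1\}$ such that $V(w_1,x)=1$ and $w_1\leq w_2$ imply $V(w_2,x)=1$, and $V(g,\bot)=0$. Interpretation: $I(w,p)=V(w,p)$, $I(w,\bot)=V(w,\bot)$; $I(w,A\land B)=1$ iff both are 1; $I(w,A\lor B)=1$ iff at least one is 1; $I(w,A\supset B)=1$ iff $I(g,A)\neq1$ or $I(w,B)=1$; $I(w,A\to B)=1$ iff for all $x\geq w$, $I(x,A)=1$ implies $I(x,B)=1$. $\Gamma\models_{\bot_w}A$ iff in every such model, $I(g,B)=1$ for all $B\in\Gamma$ implies $I(g,A)=1$. *)

theory Defs
  imports Main "HOL-Library.Countable"
begin

datatype 'p form =
    Var 'p
  | Bot  ("\<bottom>\<^sub>w")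
  | Conj "'p form" "'p form"  (infixr "\<^bold>\<and>" 70)
  | Disj "'p form" "'p form"  (infixr "\<^bold>\<or>" 65)
  | Imp "'p form" "'p form"  (infixr "\<^bold>\<rightarrow>" 60)
  | Mimp "'p form" "'p form"  (infixr "\<^bold>\<supset>" 60)

inductive axm :: "'p form \<Rightarrow> bool" where
  Ax1: "axm (A \<^bold>\<rightarrow> (B \<^bold>\<rightarrow> A))"
| Ax2: "axm ((A \<^bold>\<rightarrow> (B \<^bold>\<rightarrow> C)) \<^bold>\<rightarrow> ((A \<^bold>\<rightarrow> B) \<^bold>\<rightarrow> (A \<^bold>\<rightarrow> C)))"
| Ax3: "axm ((A \<^bold>\<and> B) \<^bold>\<rightarrow> A)"
| Ax4: "axm ((A \<^bold>\<and> B) \<^bold>\<rightarrow> B)"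
| Ax5: "axm ((C \<^bold>\<rightarrow> A) \<^bold>\<rightarrow> ((C \<^bold>\<rightarrow> B) \<^bold>\<rightarrow> (C \<^bold>\<rightarrow> (A \<^bold>\<and> B))))"
| Ax6: "axm (A \<^bold>\<rightarrow> (A \<^bold>\<or> B))"
| Ax7: "axm (B \<^bold>\<rightarrow> (A \<^bold>\<or> B))"
| Ax8: "axm ((A \<^bold>\<rightarrow> C) \<^bold>\<rightarrow> ((B \<^bold>\<rightarrow> C) \<^bold>\<rightarrow> ((A \<^bold>\<or> B) \<^bold>\<rightarrow> C)))"
| AxM1: "axm ((A \<^bold>\<rightarrow> B) \<^bold>\<supset> (A \<^bold>\<supset> B))"
| AxM2: "axm ((A \<^bold>\<supset> (B \<^bold>\<supset> C)) \<^bold>\<rightarrow> ((A \<^bold>\<supset> B) \<^bold>\<supset> (A \<^bold>\<supset> C)))"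
| AxM3: "axm ((A \<^bold>\<supset> (B \<^bold>\<rightarrow> C)) \<^bold>\<rightarrow> (B \<^bold>\<rightarrow> (A \<^bold>\<supset> C)))"
| AxM4: "axm ((A \<^bold>\<rightarrow> (B \<^bold>\<supset> C)) \<^bold>\<rightarrow> (B \<^bold>\<supset> (A \<^bold>\<rightarrow> C)))"
| AxM5: "axm (((A \<^bold>\<supset> B) \<^bold>\<supset> C) \<^bold>\<rightarrow> ((A \<^bold>\<supset> C) \<^bold>\<rightarrow> C))"
| AxM6: "axm ((A \<^bold>\<supset> C) \<^bold>\<rightarrow> ((B \<^bold>\<supset> C) \<^bold>\<rightarrow> ((A \<^bold>\<or> B) \<^bold>\<supset> C)))"
| AxE: "axm (\<bottom>\<^sub>w \<^bold>\<supset> A)"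

inductive derives :: "'p form set \<Rightarrow> 'p form \<Rightarrow> bool"  (infix "\<turnstile>\<^sub>w" 50)
  for \<Gamma> :: "'p form set" where
  Prem: "A \<in> \<Gamma> \<Longrightarrow> \<Gamma> \<turnstile>\<^sub>w A"
| Ax: "axm A \<Longrightarrow> \<Gamma> \<turnstile>\<^sub>w A"
| MP: "\<Gamma> \<turnstile>\<^sub>w A \<Longrightarrow> \<Gamma> \<turnstile>\<^sub>w (A \<^bold>\<supset> B) \<Longrightarrow> \<Gamma> \<turnstile>\<^sub>w B"

(* The second argument of val ranges over Prop \<union> {\<bottom>}:
   Some p stands for the variable p, None for \<bottom>. *)
record ('w, 'p) model =
  base :: 'w
  worlds :: "'w set"
  le :: "'w \<Rightarrow> 'w \<Rightarrow> bool"
  val :: "'w \<Rightarrow> 'p option \<Rightarrow> bool"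

definition is_model :: "('w, 'p) model \<Rightarrow> bool" where
  "is_model M \<longleftrightarrow>
     base M \<in> worlds M \<and>
     reflp_on (worlds M) (le M) \<and>
     transp_on (worlds M) (le M) \<and>
     (\<forall>w\<in>worlds M. le M (base M) w) \<and>
     (\<forall>w1\<in>worlds M. \<forall>w2\<in>worlds M. \<forall>x. val M w1 x \<longrightarrow> le M w1 w2 \<longrightarrow> val M w2 x) \<and>
     \<not> val M (base M) None"

primrec interp :: "('w, 'p) model \<Rightarrow> 'w \<Rightarrow> 'p form \<Rightarrow> bool" where
  "interp M w (Var p) \<longleftrightarrow> val M w (Some p)"
| "interp M w \<bottom>\<^sub>w \<longleftrightarrow> val M w None"
| "interp M w (A \<^bold>\<and> B) \<longleftrightarrow> interp M w A \<and> interp M w B"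
| "interp M w (A \<^bold>\<or> B) \<longleftrightarrow> interp M w A \<or> interp M w B"
| "interp M w (A \<^bold>\<supset> B) \<longleftrightarrow> \<not> interp M (base M) A \<or> interp M w B"
| "interp M w (A \<^bold>\<rightarrow> B) \<longleftrightarrow>
     (\<forall>x\<in>worlds M. le M w x \<longrightarrow> interp M x A \<longrightarrow> interp M x B)"

(* HOL cannot quantify over types inside a formula, so the type of the worlds
   is an explicit parameter of semantic consequence. Consequence over all models
   implies consequence over models whose worlds are taken from the type of sets of
   formulas; so completeness over the latter type, with soundness over an arbitrary
   type, gives the equivalence for models over arbitrary sets of worlds. *)
definition entails :: "'w itself \<Rightarrow> 'p form set \<Rightarrow> 'p form \<Rightarrow> bool" where
  "entails T \<Gamma> A \<longleftrightarrow>
     (\<forall>M :: ('w, 'p) model. is_model M \<longrightarrow>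
        (\<forall>B\<in>\<Gamma>. interp M (base M) B) \<longrightarrow> interp M (base M) A)"

abbreviation entails_in :: "'p form set \<Rightarrow> 'w itself \<Rightarrow> 'p form \<Rightarrow> bool"
    ("(_ \<Turnstile>\<^sub>w[_] _)" [51, 0, 51] 50) where
  "\<Gamma> \<Turnstile>\<^sub>w[T] A \<equiv> entails T \<Gamma> A"

end

(* Completeness is by a canonical model whose base world D is a maximal set among those that
   contain the axioms, are closed under \<supset>-detachment and avoid the unprovable formula. Its
   worlds are the prime supersets of D closed under \<rightarrow>-detachment, ordered by inclusion.
   No deduction theorem is needed: if a set T containing the axioms is closed under detachment
   for one of the two implications, then so is {F. B implies F is in T}, it extends T by B, and
   with maximality this yields primeness. AxM5 makes D classical for \<supset>; this and AxM3, AxM4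
   are what the truth lemma needs at \<supset>. Bottom may hold at worlds above D, but AxE
   excludes it from D itself. *)
theory Submission
  imports Defs
begin

section \<open>Persistence and soundness\<close>

lemma interp_mono:
  assumes M: "is_model M" and "w \<in> worlds M" "v \<in> worlds M" "le M w v" "interp M w A"
  shows "interp M v A"
  using assms(2-)
proof (induction A arbitrary: w v)
  case (Imp A B)
  have "le M w x" if "x \<in> worlds M" "le M v x" for x
    using M Imp.prems that unfolding is_model_def by (blast dest: transp_onD)
  with Imp.prems show ?case by auto
next
  case (Var p)
  with M show ?case unfolding is_model_def interp.simps by blast
next
  case Bot
  with M show ?case unfolding is_model_def interp.simps by blast
qed auto

lemma axm_sound:
  assumes M: "is_model M" and "axm A"
  shows "interp M (base M) A"
proof -
  have g: "base M \<in> worlds M" and refl: "\<And>w. w \<in> worlds M \<Longrightarrow> le M w w"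
    and bot: "\<not> val M (base M) None"
    using M unfolding is_model_def by (auto dest: reflp_onD)
  have trans: "\<And>u v w. \<lbrakk>u \<in> worlds M; v \<in> worlds M; w \<in> worlds M; le M u v; le M v w\<rbrakk>
      \<Longrightarrow> le M u w"
    using M unfolding is_model_def by (blast dest: transp_onD)
  note mono = interp_mono[OF M]
  from \<open>axm A\<close> show ?thesis
  proof cases
    case (Ax1 A B)
    show ?thesis unfolding Ax1 interp.simps using mono by blast
  next
    case (Ax2 A B C)
    show ?thesis unfolding Ax2 interp.simps
    proof (intro ballI impI, goal_cases)
      case (1 u v w)
      \<comment> \<open>The outer arrow, assumed at \<open>u\<close>, is applied at
        \<open>w\<close>; reflexivity then allows its inner arrow to be applied at \<open>w\<close>
        as well.\<close>
      then have "le M u w" by (meson trans)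
      with 1 refl[of w] show ?case by blast
    qed
  next
    case (Ax5 C A B)
    show ?thesis unfolding Ax5 interp.simps
    proof (intro ballI impI, goal_cases)
      case (1 u v w)
      then have "le M u w" by (meson trans)
      with 1 show ?case by blast
    qed
  next
    case (Ax8 A C B)
    show ?thesis unfolding Ax8 interp.simps
    proof (intro ballI impI, goal_cases)
      case (1 u v w)
      then have "le M u w" by (meson trans)
      with 1 show ?case by blast
    qed
  next
    case (AxM1 A B)
    show ?thesis unfolding AxM1 interp.simps using g refl by blast
  next
    case (AxM3 A B C)
    show ?thesis unfolding AxM3 interp.simps by blast
  next
    case (AxM5 A B C)
    \<comment> \<open>If \<open>A\<close> fails at the base, then \<open>A \<supset> B\<close> holds
      there, so \<open>C\<close> holds where the first antecedent was assumed and persists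
      upwards.\<close>
    show ?thesis unfolding AxM5 interp.simps using mono by blast
  next
    case (AxM6 A C B)
    show ?thesis unfolding AxM6 interp.simps using mono by blast
  next
    case (AxE A)
    show ?thesis unfolding AxE interp.simps using bot by blast
  qed auto
qed

lemma soundness: "\<Gamma> \<turnstile>\<^sub>w A \<Longrightarrow> \<Gamma> \<Turnstile>\<^sub>w[T] A"
  by (induction rule: derives.induct) (auto simp: entails_def axm_sound)

section \<open>Theories and their maximal extensions\<close>

definition mp_closed :: "('p form \<Rightarrow> 'p form \<Rightarrow> 'p form) \<Rightarrow> 'p form set \<Rightarrow> bool" where
  "mp_closed imp T \<longleftrightarrow> (\<forall>A B. imp A B \<in> T \<longrightarrow> A \<in> T \<longrightarrow> B \<in> T)"

definition prime :: "'p form set \<Rightarrow> bool" where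
  "prime T \<longleftrightarrow> (\<forall>A B. A \<^bold>\<or> B \<in> T \<longrightarrow> A \<in> T \<or> B \<in> T)"

lemma mp_closedD: "mp_closed imp T \<Longrightarrow> imp A B \<in> T \<Longrightarrow> A \<in> T \<Longrightarrow> B \<in> T"
  unfolding mp_closed_def by blast

text \<open>With the connective as a parameter, one Zorn argument serves \<supset> (for the base
  world) and \<rightarrow> (for the worlds above it).\<close>

lemma ex_maximal_avoiding:
  assumes "mp_closed imp T" "A \<notin> T"
  obtains M where "T \<subseteq> M" "mp_closed imp M" "A \<notin> M"
    "\<And>N. \<lbrakk>M \<subseteq> N; mp_closed imp N; A \<notin> N\<rbrakk> \<Longrightarrow> N = M"
proof -
  let ?S = "{N. T \<subseteq> N \<and> mp_closed imp N \<and> A \<notin> N}"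
  have "\<exists>M\<in>?S. \<forall>N\<in>?S. M \<subseteq> N \<longrightarrow> N = M"
  proof (rule subset_Zorn_nonempty)
    show "?S \<noteq> {}" using assms by blast
  next
    fix \<C> assume "\<C> \<noteq> {}" and chain: "subset.chain ?S \<C>"
    have "mp_closed imp (\<Union>\<C>)"
      unfolding mp_closed_def
    proof (intro allI impI)
      fix B C assume "imp B C \<in> \<Union>\<C>" "B \<in> \<Union>\<C>"
      then obtain X Y where XY: "X \<in> \<C>" "Y \<in> \<C>" "imp B C \<in> X" "B \<in> Y" by blast
      with chain have "X \<subseteq> Y \<or> Y \<subseteq> X" unfolding subset_chain_def by blast
      then obtain Z where "Z \<in> \<C>" "imp B C \<in> Z" "B \<in> Z" using XY by blast
      with chain show "C \<in> \<Union>\<C>" unfolding subset_chain_def by (blast dest: mp_closedD)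
    qed
    with \<open>\<C> \<noteq> {}\<close> chain show "\<Union>\<C> \<in> ?S" unfolding subset_chain_def by blast
  qed
  then obtain M where "M \<in> ?S" and max: "\<forall>N\<in>?S. M \<subseteq> N \<longrightarrow> N = M" by blast
  then show thesis by (intro that[of M]) blast+
qed

text \<open>What every canonical world satisfies. Closure under \<supset> is reserved for the base:
  since \<supset> tests its antecedent there, a higher world may contain \<open>A\<close> and
  \<open>A \<supset> B\<close> without \<open>B\<close>.\<close>

locale imp_theory =
  fixes T :: "'p form set"
  assumes axm_mem: "axm A \<Longrightarrow> A \<in> T"
    and imp_closed: "mp_closed Imp T"
begin

lemma mp: "A \<^bold>\<rightarrow> B \<in> T \<Longrightarrow> A \<in> T \<Longrightarrow> B \<in> T"
  using imp_closed by (rule mp_closedD)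

lemma axm_mp: "axm (A \<^bold>\<rightarrow> B) \<Longrightarrow> A \<in> T \<Longrightarrow> B \<in> T"
  by (rule mp[OF axm_mem])

lemma imp_weaken: "B \<in> T \<Longrightarrow> A \<^bold>\<rightarrow> B \<in> T"
  by (rule axm_mp[OF Ax1])

text \<open>The combinator identity S K K.\<close>

lemma imp_refl: "A \<^bold>\<rightarrow> A \<in> T"
  by (rule mp[OF axm_mp[OF Ax2 axm_mem[OF Ax1]] axm_mem[OF Ax1]])

lemma conj_mem_iff: "A \<^bold>\<and> B \<in> T \<longleftrightarrow> A \<in> T \<and> B \<in> T"
  \<comment> \<open>\<open>Ax5\<close> introduces a conjunction only under an antecedent
    \<open>C\<close>; taking \<open>A\<close> itself for \<open>C\<close> removes this
    restriction.\<close>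
  using axm_mp[OF Ax3, of A B] axm_mp[OF Ax4, of A B]
    mp[OF mp[OF axm_mp[OF Ax5 imp_refl] imp_weaken], of B A] by blast

lemma disj_memI: "A \<in> T \<or> B \<in> T \<Longrightarrow> A \<^bold>\<or> B \<in> T"
  using axm_mp Ax6 Ax7 by blast

lemma mp_closed_residual: "mp_closed Imp {F. A \<^bold>\<rightarrow> F \<in> T}"
  unfolding mp_closed_def using mp[OF axm_mp[OF Ax2]] by blast

lemma ex_prime_avoiding:
  assumes "A \<notin> T"
  obtains M where "T \<subseteq> M" "mp_closed Imp M" "prime M" "A \<notin> M"
proof -
  obtain M where M: "T \<subseteq> M" "mp_closed Imp M" "A \<notin> M"
    and max: "\<And>N. \<lbrakk>M \<subseteq> N; mp_closed Imp N; A \<notin> N\<rbrakk> \<Longrightarrow> N = M"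
    by (rule ex_maximal_avoiding[OF imp_closed assms]) blast
  interpret M: imp_theory M
    using M axm_mem by unfold_locales auto
  \<comment> \<open>If the residual of \<open>M\<close> by \<open>B\<close> avoided
    \<open>A\<close>, maximality would equate it with \<open>M\<close>, yet it contains
    \<open>B\<close>.\<close>
  have imp: "B \<^bold>\<rightarrow> A \<in> M" if "B \<notin> M" for B
  proof (rule ccontr)
    assume "B \<^bold>\<rightarrow> A \<notin> M"
    then have "{F. B \<^bold>\<rightarrow> F \<in> M} = M"
      by (intro max) (auto intro: M.imp_weaken M.mp_closed_residual)
    with M.imp_refl that show False by blast
  qed
  \<comment> \<open>Were both disjuncts outside \<open>M\<close>, both would imply \<open>A\<close>,
    and \<open>Ax8\<close> would put \<open>A\<close> into \<open>M\<close>.\<close>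
  have "prime M"
    unfolding prime_def using imp M(3) M.mp[OF M.mp[OF M.axm_mp[OF Ax8]]] by blast
  with M that show thesis by blast
qed

end

locale mimp_theory =
  fixes T :: "'p form set"
  assumes axm_mem': "axm A \<Longrightarrow> A \<in> T"
    and mimp_closed: "mp_closed Mimp T"
begin

lemma mmp: "A \<^bold>\<supset> B \<in> T \<Longrightarrow> A \<in> T \<Longrightarrow> B \<in> T"
  using mimp_closed by (rule mp_closedD)

lemma imp_imp_mimp: "A \<^bold>\<rightarrow> B \<in> T \<Longrightarrow> A \<^bold>\<supset> B \<in> T"
  by (rule mmp[OF axm_mem'[OF AxM1]])

sublocale imp_theory T
proof
  show "mp_closed Imp T"
    unfolding mp_closed_def using mmp[OF imp_imp_mimp] by blast
qed (rule axm_mem')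

lemma mimp_weaken: "B \<in> T \<Longrightarrow> A \<^bold>\<supset> B \<in> T"
  by (intro imp_imp_mimp imp_weaken)

text \<open>The main connective is \<rightarrow> here and in \<open>mimp_imp\<close>, so that both
  can be detached in worlds above \<open>T\<close>, which are closed under \<rightarrow>
  only.\<close>

lemma imp_mimp: "B \<^bold>\<rightarrow> (A \<^bold>\<supset> B) \<in> T"
  by (rule axm_mp[OF AxM3]) (intro mimp_weaken imp_refl)

lemma mimp_imp: "A \<in> T \<Longrightarrow> (A \<^bold>\<supset> B) \<^bold>\<rightarrow> B \<in> T"
  \<comment> \<open>\<open>AxM4\<close> swaps the two antecedents in the identity on
    \<open>A \<supset> B\<close>.\<close>
  by (rule mmp[OF axm_mp[OF AxM4 imp_refl]])

lemma mp_closed_residual_mimp: "mp_closed Mimp {F. A \<^bold>\<supset> F \<in> T}"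
  unfolding mp_closed_def using mmp[OF axm_mp[OF AxM2]] by blast

lemma ex_maximal_classical:
  assumes "A \<notin> T"
  obtains M where "T \<subseteq> M" "mimp_theory M" "A \<notin> M" "prime M" "\<bottom>\<^sub>w \<notin> M"
    "\<And>B C. B \<notin> M \<Longrightarrow> B \<^bold>\<supset> C \<in> M"
proof -
  obtain M where M: "T \<subseteq> M" "mp_closed Mimp M" "A \<notin> M"
    and max: "\<And>N. \<lbrakk>M \<subseteq> N; mp_closed Mimp N; A \<notin> N\<rbrakk> \<Longrightarrow> N = M"
    by (rule ex_maximal_avoiding[OF mimp_closed assms]) blast
  interpret M: mimp_theory M
    using M axm_mem by unfold_locales auto
  have mimp: "B \<^bold>\<supset> A \<in> M" if "B \<notin> M" for B
  proof (rule ccontr)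
    assume "B \<^bold>\<supset> A \<notin> M"
    then have "{F. B \<^bold>\<supset> F \<in> M} = M"
      by (intro max) (auto intro: M.mimp_weaken M.mp_closed_residual_mimp)
    with M.imp_refl M.imp_imp_mimp that show False by blast
  qed
  have "prime M"
    unfolding prime_def using mimp M(3) M.mmp[OF M.mp[OF M.axm_mp[OF AxM6]]] by blast
  moreover have "\<bottom>\<^sub>w \<notin> M"
    using M(3) M.mmp[OF M.axm_mem[OF AxE]] by blast
  \<comment> \<open>Otherwise \<open>mimp\<close> gives both
    \<open>(B \<supset> C) \<supset> A\<close> and \<open>B \<supset> A\<close>, from which
    \<open>AxM5\<close> yields \<open>A\<close>.\<close>
  moreover have "B \<^bold>\<supset> C \<in> M" if "B \<notin> M" for B C
    using that mimp M(3) M.mp[OF M.axm_mp[OF AxM5]] by blast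
  ultimately show thesis using that M M.mimp_theory_axioms by blast
qed

end

lemma mimp_theory_derives: "mimp_theory {F. \<Gamma> \<turnstile>\<^sub>w F}"
proof
  show "mp_closed Mimp {F. \<Gamma> \<turnstile>\<^sub>w F}"
    unfolding mp_closed_def using MP by blast
qed (simp add: Ax)

section \<open>The canonical model\<close>

definition canonical :: "'p form set \<Rightarrow> ('p form set, 'p) model" where
  "canonical D = \<lparr>base = D, worlds = {w. D \<subseteq> w \<and> mp_closed Imp w \<and> prime w}, le = (\<subseteq>),
     val = (\<lambda>w x. (case x of None \<Rightarrow> \<bottom>\<^sub>w | Some p \<Rightarrow> Var p) \<in> w)\<rparr>"

locale classical_theory = mimp_theory D for D :: "'p form set" +
  assumes prime: "prime D"
    and consistent: "\<bottom>\<^sub>w \<notin> D"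
    and classical: "B \<notin> D \<Longrightarrow> B \<^bold>\<supset> C \<in> D"
begin

lemma is_model_canonical: "is_model (canonical D)"
  using imp_closed prime consistent
  by (auto simp: is_model_def canonical_def intro!: reflp_onI transp_onI)

lemma truth:
  assumes "w \<in> worlds (canonical D)"
  shows "interp (canonical D) w A \<longleftrightarrow> A \<in> w"
  using assms
proof (induction A arbitrary: w)
  case (Mimp B C)
  then have w: "D \<subseteq> w" "mp_closed Imp w"
    by (auto simp: canonical_def)
  \<comment> \<open>If \<open>B\<close> is outside \<open>D\<close>, classicality puts
    \<open>B \<supset> C\<close> into \<open>D\<close> and so into \<open>w\<close>. If
    \<open>B\<close> is in \<open>D\<close>, then \<open>D\<close> contains \<rightarrow> both ways
    between \<open>B \<supset> C\<close> and \<open>C\<close>.\<close>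
  have "B \<^bold>\<supset> C \<in> w \<longleftrightarrow> B \<notin> D \<or> C \<in> w"
    using w(1) mimp_imp[of B C] imp_mimp[of C B] classical[of B C]
      mp_closedD[OF w(2), of "B \<^bold>\<supset> C" C] mp_closedD[OF w(2), of C "B \<^bold>\<supset> C"] by blast
  moreover have "D \<in> worlds (canonical D)" "base (canonical D) = D"
    using imp_closed prime by (auto simp: canonical_def)
  ultimately show ?case
    using Mimp by simp
next
  case (Imp B C)
  then interpret w: imp_theory w
    using axm_mem by unfold_locales (auto simp: canonical_def)
  have "B \<^bold>\<rightarrow> C \<in> w"
    if *: "\<And>x. \<lbrakk>x \<in> worlds (canonical D); w \<subseteq> x; B \<in> x\<rbrakk> \<Longrightarrow> C \<in> x"
  proof (rule ccontr)
    assume "B \<^bold>\<rightarrow> C \<notin> w"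
    \<comment> \<open>The refuting world is a prime extension of the residual of \<open>w\<close> by
      \<open>B\<close> that avoids \<open>C\<close>.\<close>
    interpret R: imp_theory "{F. B \<^bold>\<rightarrow> F \<in> w}"
      by unfold_locales (auto intro: w.imp_weaken w.axm_mem w.mp_closed_residual)
    obtain x where "{F. B \<^bold>\<rightarrow> F \<in> w} \<subseteq> x" "mp_closed Imp x" "prime x" "C \<notin> x"
      using R.ex_prime_avoiding \<open>B \<^bold>\<rightarrow> C \<notin> w\<close> by blast
    moreover from this have "w \<subseteq> x" "B \<in> x"
      using w.imp_weaken w.imp_refl by blast+
    moreover have "D \<subseteq> w"
      using Imp.prems by (simp add: canonical_def)
    ultimately show False
      using *[of x] by (auto simp: canonical_def)
  qed
  moreover have "C \<in> x"
    if "B \<^bold>\<rightarrow> C \<in> w" "x \<in> worlds (canonical D)" "w \<subseteq> x" "B \<in> x" for x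
    using that mp_closedD[of Imp x B C] by (auto simp: canonical_def)
  moreover have "le (canonical D) = (\<subseteq>)"
    by (simp add: canonical_def)
  ultimately show ?case
    using Imp.IH by auto
next
  case (Conj B C)
  then interpret w: imp_theory w
    using axm_mem by unfold_locales (auto simp: canonical_def)
  show ?case using Conj by (simp add: w.conj_mem_iff)
next
  case (Disj B C)
  then interpret w: imp_theory w
    using axm_mem by unfold_locales (auto simp: canonical_def)
  have "prime w" using Disj.prems by (simp add: canonical_def)
  then have "B \<^bold>\<or> C \<in> w \<longleftrightarrow> B \<in> w \<or> C \<in> w"
    using w.disj_memI unfolding prime_def by blast
  with Disj show ?case by simp
qed (auto simp: canonical_def)

lemma interp_base: "interp (canonical D) (base (canonical D)) A \<longleftrightarrow> A \<in> D"
  using truth[of D A] imp_closed prime by (simp add: canonical_def)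

end

section \<open>Completeness and the equivalence\<close>

lemma completeness:
  fixes \<Gamma> :: "'p form set"
  assumes "\<Gamma> \<Turnstile>\<^sub>w[TYPE('p form set)] A"
  shows "\<Gamma> \<turnstile>\<^sub>w A"
proof (rule ccontr)
  assume "\<not> \<Gamma> \<turnstile>\<^sub>w A"
  then obtain D where D: "{F. \<Gamma> \<turnstile>\<^sub>w F} \<subseteq> D" "mimp_theory D" "A \<notin> D" "prime D" "\<bottom>\<^sub>w \<notin> D"
    "\<And>B C. B \<notin> D \<Longrightarrow> B \<^bold>\<supset> C \<in> D"
    using mimp_theory.ex_maximal_classical[OF mimp_theory_derives[of \<Gamma>], of A] by blast
  then interpret classical_theory D
    by (intro classical_theory.intro classical_theory_axioms.intro)
  have "\<forall>B\<in>\<Gamma>. interp (canonical D) (base (canonical D)) B"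
    using D(1) by (auto simp: interp_base intro: Prem)
  with assms is_model_canonical have "interp (canonical D) (base (canonical D)) A"
    unfolding entails_def by blast
  then have "A \<in> D" by (simp only: interp_base)
  with D(3) show False ..
qed

theorem mainTheorem18:
  fixes \<Gamma> :: "'p::countable form set" and A :: "'p form"
  shows "(\<Gamma> \<turnstile>\<^sub>w A \<longleftrightarrow> \<Gamma> \<Turnstile>\<^sub>w[TYPE('p form set)] A) \<and>
         (\<Gamma> \<turnstile>\<^sub>w A \<longrightarrow> \<Gamma> \<Turnstile>\<^sub>w[TYPE('w)] A)"
  by (intro conjI iffI impI) (rule soundness completeness, assumption)+

end
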